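(* Let $\{X_n:n\geq 1\}$ be a sequence of i.i.d. real random variables on a probability space $(\Omega,\mathcal{F},P)$ with common distribution function $F$ such that $\omega_F:=\sup\{x\in\mathbb{R}:F(x)<1\}=\infty$. Assume that, for $x$ large enough, $F$ is strictly increasing with positive density $f$. Let $\bar{F}(x):=1-F(x)$ and $w(x):=\frac{\bar{F}(x)}{f(x)}$, and assume that $w$ is differentiable for $x$ large enough, that $\lim_{x\to\infty}w'(x)=0$, and that $w$ is regularly varying with exponent $1-\mu$ for some $\mu>0$, i.e. $\lim_{x\to\infty}\frac{w(tx)}{w(x)}=t^{1-\mu}$ for all $t>0$. For $n$ large enough (say $n\geq n_0$) let $$m_n:=F^{-1}\left(1-\frac{1}{n}\right),\qquad h_n:=m_n\,n\,f(m_n),\qquad M_n:=\max\{X_1,\ldots,X_n\}.$$ Then, for every family of positive numbers $\{a_n\}$ such that $a_n\to 0$ and $a_nh_n\to\infty$ as $n\to\infty$, the sequence of random variables $\left\{a_nh_n\left(\frac{M_n}{m_n}-1\right):n\geq n_0\right\}$ satisfies the large deviation principle with speed $1/a_n$ and rate function $I_{\mathrm{MD}}:\mathbb{R}\to[0,\infty]$ defined by $$I_{\mathrm{MD}}(x):=\begin{cases}x&\text{if }x\in[0,\infty)\\ \infty&\text{otherwise.}\end{cases}$$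
   Context: Large deviation principle (LDP): a speed is a sequence $\{v_n\}$ with $v_n\to\infty$; a rate function on $\mathbb{R}$ is a lower semicontinuous function $I:\mathbb{R}\to[0,\infty]$ (its level sets are not required to be compact in the definition). A sequence $\{Z_n\}$ of real random variables satisfies the LDP with speed $v_n$ and rate function $I$ if $$\limsup_{n\to\infty}\frac{1}{v_n}\log P(Z_n\in C)\leq-\inf_{x\in C}I(x)\quad\text{for all closed sets }C\subset\mathbb{R},$$ $$\liminf_{n\to\infty}\frac{1}{v_n}\log P(Z_n\in O)\geq-\inf_{x\in O}I(x)\quad\text{for all open sets }O\subset\mathbb{R},$$ with the conventions $\log 0=-\infty$ and $\inf\emptyset=\infty$. The integer $n_0$ is chosen large enough that $m_n$ and $h_n$ are well defined for all $n\geq n_0$ (for large $n$, $m_n$ is the unique point in the region where $F$ is strictly increasing with density $f$ such that $F(m_n)=1-\frac1n$) and $m_n\neq 0$. *)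

theory Defs
  imports "HOL-Probability.Probability"
begin

definition ereal_log :: "real \<Rightarrow> ereal" where
  "ereal_log p = (if p = 0 then -\<infinity> else ereal (ln p))"

definition lower_semicontinuous :: "(real \<Rightarrow> ereal) \<Rightarrow> bool" where
  "lower_semicontinuous I \<longleftrightarrow> (\<forall>x. I x \<le> Liminf (at x) I)"

definition rate_function :: "(real \<Rightarrow> ereal) \<Rightarrow> bool" where
  "rate_function I \<longleftrightarrow> (\<forall>x. 0 \<le> I x) \<and> lower_semicontinuous I"

(* The LDP for the family (Z n) indexed by n >= n0. The infimum over the empty set is
   top = infinity in ereal. *)
definition satisfies_LDP ::
  "'a measure \<Rightarrow> nat \<Rightarrow> (nat \<Rightarrow> 'a \<Rightarrow> real) \<Rightarrow> (nat \<Rightarrow> real) \<Rightarrow> (real \<Rightarrow> ereal) \<Rightarrow> bool" where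
  "satisfies_LDP M n0 Z v I \<longleftrightarrow>
     (\<forall>n\<ge>n0. Z n \<in> borel_measurable M) \<and>
     filterlim v at_top sequentially \<and>
     rate_function I \<and>
     (\<forall>C. closed C \<longrightarrow>
        limsup (\<lambda>n. ereal (1 / v n) * ereal_log (measure M {\<omega> \<in> space M. Z n \<omega> \<in> C}))
          \<le> - (INF x\<in>C. I x)) \<and>
     (\<forall>U. open U \<longrightarrow>
        liminf (\<lambda>n. ereal (1 / v n) * ereal_log (measure M {\<omega> \<in> space M. Z n \<omega> \<in> U}))
          \<ge> - (INF x\<in>U. I x))"

definition right_endpoint :: "(real \<Rightarrow> real) \<Rightarrow> ereal" where
  "right_endpoint F = (SUP x\<in>{x. F x < 1}. ereal x)"

(* On the half-line from x0 on, F is strictly increasing and absolutely continuous with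
   positive density f. Since f > 0 there, this gauge integral is the Lebesgue integral. *)
definition increasing_with_density_from ::
  "(real \<Rightarrow> real) \<Rightarrow> (real \<Rightarrow> real) \<Rightarrow> real \<Rightarrow> bool" where
  "increasing_with_density_from F f x0 \<longleftrightarrow>
     strict_mono_on {x0..} F \<and>
     (\<forall>x\<ge>x0. 0 < f x) \<and>
     (\<forall>a b. x0 \<le> a \<longrightarrow> a \<le> b \<longrightarrow> (f has_integral (F b - F a)) {a..b})"

definition regularly_varying :: "(real \<Rightarrow> real) \<Rightarrow> real \<Rightarrow> bool" where
  "regularly_varying g \<rho> \<longleftrightarrow>
     (\<forall>t>0. ((\<lambda>x. g (t * x) / g x) \<longlongrightarrow> t powr \<rho>) at_top)"

definition w_fun :: "(real \<Rightarrow> real) \<Rightarrow> (real \<Rightarrow> real) \<Rightarrow> real \<Rightarrow> real" where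
  "w_fun F f x = (1 - F x) / f x"

(* The inverse of F is taken on the half-line from x0 on, where F is injective; the value
   is meaningful only if 1 - 1/n is attained there. *)
definition m_seq :: "(real \<Rightarrow> real) \<Rightarrow> real \<Rightarrow> nat \<Rightarrow> real" where
  "m_seq F x0 n = the_inv_into {x0..} F (1 - 1 / real n)"

definition h_seq :: "(real \<Rightarrow> real) \<Rightarrow> (real \<Rightarrow> real) \<Rightarrow> real \<Rightarrow> nat \<Rightarrow> real" where
  "h_seq F f x0 n = m_seq F x0 n * real n * f (m_seq F x0 n)"

definition admissible_index :: "(real \<Rightarrow> real) \<Rightarrow> real \<Rightarrow> nat \<Rightarrow> bool" where
  "admissible_index F x0 n0 \<longleftrightarrow>
     1 \<le> n0 \<and> (\<forall>n\<ge>n0. 1 - 1 / real n \<in> F ` {x0..} \<and> m_seq F x0 n \<noteq> 0)"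

definition max_seq :: "(nat \<Rightarrow> 'a \<Rightarrow> real) \<Rightarrow> nat \<Rightarrow> 'a \<Rightarrow> real" where
  "max_seq X n \<omega> = Max ((\<lambda>i. X i \<omega>) ` {1..n})"

definition I_MD :: "real \<Rightarrow> ereal" where
  "I_MD x = (if 0 \<le> x then ereal x else \<infinity>)"

end

theory Submission
  imports Defs
begin

text \<open>
  Since \<open>1 - F (m n) = 1 / n\<close>, we have \<open>h n = m n / w (m n)\<close>, so the event that the normalised
  maximum exceeds \<open>x\<close> is the event that the maximum exceeds \<open>y n = m n + x * w (m n) / a n\<close>.
  The derivative of \<open>ln (1 - F)\<close> is \<open>- 1 / w\<close>, so the mean value theorem gives
  \<open>ln (n * (1 - F (y n))) = - (x / a n) * (w (m n) / w \<xi>)\<close> with \<open>\<xi>\<close> between \<open>m n\<close> and \<open>y n\<close>.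
  Here \<open>\<xi> / m n \<longlonglongrightarrow> 1\<close> because \<open>a n * h n\<close> diverges, and the uniform convergence theorem for
  regularly varying functions yields \<open>w (m n) / w \<xi> \<longlonglongrightarrow> 1\<close>. Hence \<open>n * (1 - F (y n))\<close> is
  \<open>exp (- (x + o(1)) / a n)\<close>; it is comparable to the upper tail probability for \<open>x > 0\<close>, and for
  \<open>x < 0\<close> the lower tail probability is at most \<open>exp\<close> of its negative, which is super-exponentially
  small.
\<close>

section \<open>Uniform convergence for regularly varying functions\<close>

text \<open>
  The uniform convergence theorem in additive form. By Baire, for some \<open>N\<close> the set \<open>V N\<close> of shifts
  that are \<open>\<epsilon>/3\<close>-accurate beyond \<open>A + N\<close> contains an interval \<open>{a..b}\<close>; comparing the shifts \<open>a\<close> and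
  \<open>a + (v - u)\<close> from the base point \<open>u - a\<close> controls \<open>g v - g u\<close>.
\<close>

lemma uniform_increment:
  fixes g :: "real \<Rightarrow> real" and c A \<epsilon> :: real
  assumes cont: "continuous_on {A..} g"
    and lim: "\<And>s. ((\<lambda>u. g (u + s) - g u) \<longlongrightarrow> c * s) at_top"
    and eps: "\<epsilon> > 0"
  obtains \<delta> T where "\<delta> > 0" "\<And>u v. u \<ge> T \<Longrightarrow> v \<ge> T \<Longrightarrow> \<bar>u - v\<bar> \<le> \<delta> \<Longrightarrow> \<bar>g u - g v\<bar> \<le> \<epsilon>"
proof -
  define S :: "real set" where "S = {0..1}"
  define V where "V = (\<lambda>N::nat. {s\<in>S. \<forall>u\<ge>A + real N. \<bar>g (u + s) - g u - c * s\<bar> \<le> \<epsilon>/3})"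
  have closedV: "closed (V N)" for N
  proof -
    have "closed {s\<in>S. \<bar>g (u + s) - g u - c * s\<bar> \<le> \<epsilon>/3}" if "u \<ge> A + real N" for u
    proof (rule continuous_on_closed_Collect_le)
      have "continuous_on S (\<lambda>s. g (u + s))"
        by (rule continuous_on_compose2[OF cont]) (use that in \<open>auto intro!: continuous_intros simp: S_def\<close>)
      then show "continuous_on S (\<lambda>s. \<bar>g (u + s) - g u - c * s\<bar>)"
        by (intro continuous_intros)
    qed (auto simp: S_def intro: continuous_intros)
    then have "closed (S \<inter> (\<Inter>u\<in>{A + real N..}. {s\<in>S. \<bar>g (u + s) - g u - c * s\<bar> \<le> \<epsilon>/3}))"
      by (intro closed_Int closed_INT) (auto simp: S_def)
    also have "S \<inter> (\<Inter>u\<in>{A + real N..}. {s\<in>S. \<bar>g (u + s) - g u - c * s\<bar> \<le> \<epsilon>/3}) = V N"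
      by (auto simp: V_def)
    finally show ?thesis .
  qed
  have cover: "\<exists>N. s \<in> V N" if "s \<in> S" for s
  proof -
    have "eventually (\<lambda>u. \<bar>g (u + s) - g u - c * s\<bar> < \<epsilon>/3) at_top"
      using tendstoD[OF lim[of s], of "\<epsilon>/3"] eps by (simp add: dist_real_def)
    then obtain T where T: "\<And>u. u \<ge> T \<Longrightarrow> \<bar>g (u + s) - g u - c * s\<bar> < \<epsilon>/3"
      by (auto simp: eventually_at_top_linorder)
    obtain N :: nat where "real N \<ge> T - A"
      using real_arch_simple by blast
    with T that have "s \<in> V N"
      unfolding V_def by (smt (verit) mem_Collect_eq)
    then show ?thesis ..
  qed
  \<comment> \<open>If every \<open>S - V N\<close> were dense in \<open>S\<close>, these relatively
    open sets would have a dense intersection by Baire; but by \<open>cover\<close> the intersection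
    is empty. A point off one of the closures has a whole neighbourhood of shifts in that
    \<open>V N\<close>.\<close>
  have "\<exists>N. \<not> S \<subseteq> closure (S - V N)"
  proof (rule ccontr)
    assume *: "\<not> ?thesis"
    have "S \<subseteq> closure (\<Inter>(range (\<lambda>N. S - V N)))"
    proof (rule Baire)
      fix T assume "T \<in> range (\<lambda>N. S - V N)"
      then obtain N where "T = S - V N" by auto
      moreover have "openin (top_of_set S) (S - V N)"
        by (metis Diff_eq closedV open_Compl openin_open_Int)
      ultimately show "openin (top_of_set S) T \<and> S \<subseteq> closure T"
        using * by auto
    qed (auto simp: S_def)
    moreover have "\<Inter>(range (\<lambda>N. S - V N)) = {}"
      using cover by fastforce
    ultimately have "S \<subseteq> {}" by (metis closure_empty)
    then show False by (simp add: S_def)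
  qed
  then obtain N p where p: "p \<in> S" "p \<notin> closure (S - V N)" by auto
  then obtain e where e: "e > 0" "\<And>y. y \<in> S - V N \<Longrightarrow> \<not> dist y p < e"
    by (auto simp: closure_approachable)
  \<comment> \<open>The neighbourhood of \<open>p\<close> is clipped to the unit interval. Halving
    \<open>e\<close> keeps the endpoints strictly within distance \<open>e\<close>, and
    \<open>a < b\<close> survives even if \<open>p\<close> is 0 or 1.\<close>
  define a where "a = max 0 (p - e/2)"
  define b where "b = min 1 (p + e/2)"
  have ab: "a < b" "0 \<le> a" using p(1) e(1) by (auto simp: a_def b_def S_def)
  have V: "s \<in> V N" if "a \<le> s" "s \<le> b" for s
  proof -
    have "s \<in> S" "dist s p < e"
      using that p(1) e(1) by (auto simp: a_def b_def S_def dist_real_def abs_if)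
    with e(2) show ?thesis by blast
  qed
  \<comment> \<open>The first bound keeps \<open>a + (v - u)\<close> inside \<open>{a..b}\<close>;
    the second makes the drift \<open>c * (v - u)\<close> at most \<open>\<epsilon>/3\<close>, the
    third share of the error. Adding 1 to \<open>\<bar>c\<bar>\<close> covers
    \<open>c = 0\<close>.\<close>
  define \<delta> where "\<delta> = min (b - a) (\<epsilon> / (3 * (\<bar>c\<bar> + 1)))"
  have key: "\<bar>g v - g u\<bar> \<le> \<epsilon>" if "u \<ge> A + real N + a" "u \<le> v" "v - u \<le> \<delta>" for u v
  proof -
    have 1: "u - a \<ge> A + real N" using that by simp
    have "a \<in> V N" "a + (v - u) \<in> V N" using V that ab by (auto simp: \<delta>_def)
    with 1 have 2: "\<bar>g (u - a + a) - g (u - a) - c * a\<bar> \<le> \<epsilon>/3"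
      "\<bar>g (u - a + (a + (v - u))) - g (u - a) - c * (a + (v - u))\<bar> \<le> \<epsilon>/3"
      unfolding V_def by blast+
    have "\<bar>c * (v - u)\<bar> \<le> (\<bar>c\<bar> + 1) * (\<epsilon> / (3 * (\<bar>c\<bar> + 1)))"
      unfolding abs_mult using that by (intro mult_mono) (auto simp: \<delta>_def)
    also have "\<dots> = \<epsilon>/3" by (simp add: field_simps add_nonneg_eq_0_iff)
    finally have "\<bar>c * (v - u)\<bar> \<le> \<epsilon>/3" .
    moreover have "c * (a + (v - u)) = c * a + c * (v - u)" by (simp add: algebra_simps)
    moreover have "u - a + a = u" "u - a + (a + (v - u)) = v" by simp_all
    ultimately show ?thesis using 2 by (simp only:)
  qed
  show ?thesis
  proof
    show "\<delta> > 0" using ab eps by (simp add: \<delta>_def)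
    show "\<bar>g u - g v\<bar> \<le> \<epsilon>" if "u \<ge> A + real N + a" "v \<ge> A + real N + a" "\<bar>u - v\<bar> \<le> \<delta>" for u v
      using key[of u v] key[of v u] that by (cases "u \<le> v") auto
  qed
qed

text \<open>The substitution \<open>g u = ln (w (exp u))\<close> turns regular variation into
  convergence of the increments of \<open>g\<close>. Since \<open>ln (x n)\<close> and
  \<open>ln (y n)\<close> diverge while their difference vanishes, \<open>uniform_increment\<close>
  applies to them.\<close>

lemma regularly_varying_ratio_tendsto_1:
  fixes w :: "real \<Rightarrow> real" and x y :: "nat \<Rightarrow> real"
  assumes rv: "regularly_varying w \<rho>"
    and cont: "continuous_on {A..} w"
    and pos: "\<And>t. t \<ge> A \<Longrightarrow> w t > 0"
    and x: "filterlim x at_top sequentially"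
    and yx: "(\<lambda>n. y n / x n) \<longlonglongrightarrow> 1"
  shows "(\<lambda>n. w (x n) / w (y n)) \<longlonglongrightarrow> 1"
proof -
  define B where "B = max A 1"
  have B: "B > 0" "\<And>t. t \<ge> B \<Longrightarrow> w t > 0" using pos by (auto simp: B_def)
  define g where "g = (\<lambda>u. ln (w (exp u)))"
  have expB: "exp u \<ge> B" if "u \<ge> ln B" for u
    using that B(1) by (metis exp_le_cancel_iff exp_ln)
  have contg: "continuous_on {ln B..} g"
  proof -
    have "continuous_on {ln B..} (\<lambda>u. w (exp u))"
      by (rule continuous_on_compose2[OF cont]) (use expB in \<open>fastforce intro!: continuous_intros simp: B_def\<close>)+
    then show ?thesis
      unfolding g_def using B(2) expB by (intro continuous_intros) (auto simp: less_imp_neq[symmetric])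
  qed
  have limg: "((\<lambda>u. g (u + s) - g u) \<longlongrightarrow> \<rho> * s) at_top" for s
  proof -
    have "((\<lambda>t. w (exp s * t) / w t) \<longlongrightarrow> exp s powr \<rho>) at_top"
      using rv by (simp add: regularly_varying_def)
    then have "((\<lambda>t. ln (w (exp s * t) / w t)) \<longlongrightarrow> ln (exp s powr \<rho>)) at_top"
      by (rule tendsto_ln) simp
    from filterlim_compose[OF this exp_at_top]
    have "((\<lambda>u. ln (w (exp s * exp u) / w (exp u))) \<longlongrightarrow> \<rho> * s) at_top"
      by (simp add: ln_powr)
    moreover have "eventually (\<lambda>u. ln (w (exp s * exp u) / w (exp u)) = g (u + s) - g u) at_top"
      using eventually_ge_at_top[of "ln B"] eventually_ge_at_top[of "ln B - s"]
    proof eventually_elim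
      case (elim u)
      then have "w (exp u) > 0" "w (exp (u + s)) > 0" using B expB by auto
      then show ?case by (simp add: g_def ln_div exp_add mult.commute)
    qed
    ultimately show ?thesis by (simp add: tendsto_cong)
  qed
  have y: "filterlim y at_top sequentially"
  proof -
    have "filterlim (\<lambda>n. y n / x n * x n) at_top sequentially"
      by (rule filterlim_tendsto_pos_mult_at_top[OF yx _ x]) simp
    moreover have "eventually (\<lambda>n. y n / x n * x n = y n) sequentially"
      using x by (auto simp: filterlim_at_top_dense elim: eventually_mono[OF spec[of _ 0]])
    ultimately show ?thesis using filterlim_cong by force
  qed
  have lnx: "filterlim (\<lambda>n. ln (x n)) at_top sequentially" and lny: "filterlim (\<lambda>n. ln (y n)) at_top sequentially"
    using filterlim_compose[OF ln_at_top x] filterlim_compose[OF ln_at_top y] by auto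
  have pos_ev: "eventually (\<lambda>n. x n \<ge> B \<and> y n \<ge> B) sequentially"
    using x y by (auto simp: filterlim_at_top intro: eventually_conj)
  have lnyx: "(\<lambda>n. ln (y n) - ln (x n)) \<longlonglongrightarrow> 0"
  proof -
    have "(\<lambda>n. ln (y n / x n)) \<longlonglongrightarrow> ln 1" by (rule tendsto_ln[OF yx]) simp
    moreover have "eventually (\<lambda>n. ln (y n / x n) = ln (y n) - ln (x n)) sequentially"
      using pos_ev by eventually_elim (use B(1) in \<open>simp add: ln_div\<close>)
    ultimately show ?thesis by (simp add: tendsto_cong)
  qed
  have "(\<lambda>n. g (ln (x n)) - g (ln (y n))) \<longlonglongrightarrow> 0"
  proof (rule tendstoI)
    fix e :: real assume e: "e > 0"
    obtain \<delta> T where \<delta>: "\<delta> > 0" "\<And>u v. u \<ge> T \<Longrightarrow> v \<ge> T \<Longrightarrow> \<bar>u - v\<bar> \<le> \<delta> \<Longrightarrow> \<bar>g u - g v\<bar> \<le> e/2"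
      using uniform_increment[OF contg limg, of "e/2"] e by auto
    have "eventually (\<lambda>n. ln (x n) \<ge> T) sequentially" "eventually (\<lambda>n. ln (y n) \<ge> T) sequentially"
      using lnx lny by (auto simp: filterlim_at_top)
    moreover have "eventually (\<lambda>n. dist (ln (y n) - ln (x n)) 0 < \<delta>) sequentially"
      by (rule tendstoD[OF lnyx \<delta>(1)])
    ultimately show "eventually (\<lambda>n. dist (g (ln (x n)) - g (ln (y n))) 0 < e) sequentially"
    proof eventually_elim
      case (elim n)
      then have "\<bar>g (ln (x n)) - g (ln (y n))\<bar> \<le> e/2" by (intro \<delta>) (auto simp: dist_real_def)
      then show ?case using e by (simp add: dist_real_def)
    qed
  qed
  then have "(\<lambda>n. exp (g (ln (x n)) - g (ln (y n)))) \<longlonglongrightarrow> exp 0" by (rule tendsto_exp)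
  moreover have "eventually (\<lambda>n. exp (g (ln (x n)) - g (ln (y n))) = w (x n) / w (y n)) sequentially"
    using pos_ev
  proof eventually_elim
    case (elim n)
    then have "x n > 0" "y n > 0" "w (x n) > 0" "w (y n) > 0" using B by auto
    then show ?case by (simp add: g_def exp_diff)
  qed
  ultimately show ?thesis by (simp add: tendsto_cong)
qed

section \<open>Reduction of the large deviation principle to tail estimates\<close>

text \<open>Near a negative point \<open>I_MD\<close> is constantly infinite. Elsewhere it agrees at
  the point with the identity, which is continuous and lies below \<open>I_MD\<close>
  everywhere.\<close>

lemma I_MD_rate_function: "rate_function I_MD"
  unfolding rate_function_def lower_semicontinuous_def
proof safe
  show "0 \<le> I_MD x" for x by (simp add: I_MD_def)
  show "I_MD x \<le> Liminf (at x) I_MD" for x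
  proof (cases "x < 0")
    case True
    then have "eventually (\<lambda>y. y < 0) (at x)" by (intro order_tendstoD(2)[OF tendsto_ident_at])
    then have "eventually (\<lambda>y. I_MD x \<le> I_MD y) (at x)"
      by eventually_elim (simp add: I_MD_def)
    then show ?thesis by (rule Liminf_bounded)
  next
    case False
    have "((\<lambda>y. ereal y) \<longlongrightarrow> ereal x) (at x)" by (intro tendsto_intros)
    then have "ereal x = Liminf (at x) (\<lambda>y. ereal y)"
      by (intro lim_imp_Liminf[symmetric]) auto
    also have "\<dots> \<le> Liminf (at x) I_MD"
      by (intro Liminf_mono) (simp add: I_MD_def)
    finally show ?thesis using False by (simp add: I_MD_def)
  qed
qed

text \<open>Together with its mirror image below, this reduces both bounds of the principle to real
  rates \<open>r\<close>, so that an infinite infimum needs no separate case.\<close>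

lemma ereal_le_uminus_dense:
  fixes x y :: ereal
  assumes "\<And>r. ereal r < y \<Longrightarrow> x \<le> ereal (- r)"
  shows "x \<le> - y"
proof (rule ccontr)
  assume "\<not> ?thesis"
  then have "- x < y" using ereal_uminus_less_reorder[of y x] by (simp only: not_le)
  then obtain r where r: "- x < ereal r" "ereal r < y" using ereal_dense2 by blast
  then have "- ereal r < x" using ereal_uminus_less_reorder[of x "ereal r"] by simp
  with assms[OF r(2)] show False by simp
qed

lemma ereal_uminus_le_dense:
  fixes x y :: ereal
  assumes "\<And>r. y < ereal r \<Longrightarrow> ereal (- r) \<le> x"
  shows "- y \<le> x"
proof (rule ccontr)
  assume "\<not> ?thesis"
  then have "y < - x" using ereal_less_uminus_reorder[of x y] by (simp only: not_le)
  then obtain r where r: "y < ereal r" "ereal r < - x" using ereal_dense2 by blast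
  then have "x < - ereal r" using ereal_less_uminus_reorder[of x "ereal r"] by simp
  with assms[OF r(1)] show False by simp
qed

text \<open>The factor \<open>1 / (1 / a)\<close> is what the speed \<open>1 / a\<close> produces.
  For \<open>p = 0\<close> the left side is \<open>-\<infinity>\<close>, because the factor is
  positive.\<close>

lemma scaled_log_le:
  assumes "a > 0" "0 \<le> p" "p \<le> exp (- r / a)"
  shows "ereal (1 / (1 / a)) * ereal_log p \<le> ereal (- r)"
proof (cases "p = 0")
  case False
  then have "ln p \<le> - r / a" using assms by (metis less_eq_real_def ln_exp ln_le_cancel_iff exp_gt_zero)
  then show ?thesis using False assms by (simp add: ereal_log_def field_simps)
qed (use assms in \<open>simp add: ereal_log_def\<close>)

lemma scaled_log_ge:
  assumes "a > 0" "exp (- r / a) \<le> p"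
  shows "ereal (- r) \<le> ereal (1 / (1 / a)) * ereal_log p"
proof -
  have "p > 0" using assms(2) exp_gt_zero by (rule less_le_trans[rotated])
  moreover have "- r / a \<le> ln p" using assms \<open>p > 0\<close> by (simp add: ln_ge_iff)
  ultimately show ?thesis using assms by (simp add: ereal_log_def field_simps)
qed

text \<open>A strict gap between rates absorbs the factor 2, because \<open>(s - r) / a n\<close>
  eventually exceeds \<open>ln 2\<close>. This handles sums and differences of two tails.\<close>

lemma exp_inverse_dominates:
  fixes a :: "nat \<Rightarrow> real"
  assumes pos: "eventually (\<lambda>n. a n > 0) sequentially" and lim: "a \<longlonglongrightarrow> 0" and "r < s"
  shows "eventually (\<lambda>n. 2 * exp (- s / a n) \<le> exp (- r / a n)) sequentially"
proof -
  have "eventually (\<lambda>n. a n < (s - r) / ln 2) sequentially"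
    using \<open>r < s\<close> by (intro order_tendstoD(2)[OF lim]) simp
  with pos show ?thesis
  proof eventually_elim
    case (elim n)
    then have "ln 2 \<le> (s - r) / a n" by (simp add: field_simps)
    then have "ln 2 + - s / a n \<le> - r / a n" by (simp add: diff_divide_distrib)
    then have "exp (ln 2 + - s / a n) \<le> exp (- r / a n)" by simp
    then show ?case by (simp only: exp_add) simp
  qed
qed

text \<open>A closed set with positive infimum is covered by a left ray, whose probability is
  negligible at every rate, and a right ray. An open set contains an interval to the right of any of
  its points, whose probability is a difference of two upper tails.\<close>

lemma (in prob_space) LDP_I_MD_of_tails:
  fixes Z :: "nat \<Rightarrow> 'a \<Rightarrow> real" and a :: "nat \<Rightarrow> real"
  assumes meas: "\<And>n. n \<ge> n0 \<Longrightarrow> Z n \<in> borel_measurable M"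
    and pos: "eventually (\<lambda>n. a n > 0) sequentially" and lim: "a \<longlonglongrightarrow> 0"
    and upper: "\<And>x r. 0 < r \<Longrightarrow> r < x \<Longrightarrow>
      eventually (\<lambda>n. prob {\<omega> \<in> space M. Z n \<omega> > x} \<le> exp (- r / a n)) sequentially"
    and lower: "\<And>x r. 0 < x \<Longrightarrow> x < r \<Longrightarrow>
      eventually (\<lambda>n. exp (- r / a n) \<le> prob {\<omega> \<in> space M. Z n \<omega> > x}) sequentially"
    and left: "\<And>x r. x < 0 \<Longrightarrow>
      eventually (\<lambda>n. prob {\<omega> \<in> space M. Z n \<omega> \<le> x} \<le> exp (- r / a n)) sequentially"
  shows "satisfies_LDP M n0 Z (\<lambda>n. 1 / a n) I_MD"
  unfolding satisfies_LDP_def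
proof (intro conjI allI impI)
  show "filterlim (\<lambda>n. 1 / a n) at_top sequentially"
    using filterlim_inverse_at_top[OF lim pos] by (simp add: inverse_eq_divide)
next
  fix C :: "real set" assume C: "closed C"
  let ?P = "\<lambda>n. prob {\<omega> \<in> space M. Z n \<omega> \<in> C}"
  let ?L = "\<lambda>n. ereal (1 / (1 / a n)) * ereal_log (?P n)"
  have bound: "limsup ?L \<le> ereal (- r)" if r: "ereal r < (INF x\<in>C. I_MD x)" for r
  proof -
    have "eventually (\<lambda>n. ?P n \<le> exp (- r / a n)) sequentially"
    proof (cases "r \<le> 0")
      case True
      from pos show ?thesis
      proof eventually_elim
        case (elim n)
        with True have "0 \<le> - r / a n" by (intro divide_nonneg_pos) auto
        then have "1 \<le> exp (- r / a n)" by simp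
        then show ?case using prob_le_1 order_trans by blast
      qed
    next
      case False
      obtain s where s: "ereal r < ereal s" "ereal s < (INF x\<in>C. I_MD x)"
        using ereal_dense2[OF r] by auto
      have out: "x \<notin> C" if "0 \<le> x" "x \<le> s" for x
      proof
        assume "x \<in> C"
        then have "(INF x\<in>C. I_MD x) \<le> I_MD x" by (rule INF_lower)
        with s(2) have "ereal s < I_MD x" by (rule less_le_trans)
        with that show False by (simp add: I_MD_def)
      qed
      \<comment> \<open>Closedness of \<open>C\<close> enters here: it misses a ball around 0, hence
        lies to the left of \<open>- (e/2)\<close> or to the right of \<open>s\<close>.\<close>
      have "0 \<in> - C" using out[of 0] s False by simp
      then obtain e where e: "e > 0" "ball 0 e \<subseteq> - C"
        using C by (meson open_Compl open_contains_ball)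
      have sub: "x \<le> - (e/2) \<or> x > s" if "x \<in> C" for x
      proof (rule ccontr)
        assume "\<not> ?thesis"
        then have *: "- (e/2) < x" "x \<le> s" by auto
        show False
        proof (cases "x \<ge> 0")
          case False
          then have "x \<in> ball 0 e" using * e(1) by (simp add: dist_real_def)
          with e(2) that show False by auto
        qed (use out * that in auto)
      qed
      \<comment> \<open>Both rays get the bound \<open>exp (- s' / a n)\<close>; the gap between
        \<open>r\<close> and \<open>s'\<close> absorbs the factor 2 of their sum.\<close>
      obtain s' where s': "r < s'" "s' < s" using s(1) dense[of r s] by auto
      have s'0: "0 < s'" and e2: "- (e/2) < 0" using s'(1) False e(1) by auto
      show ?thesis
        using upper[OF s'0 s'(2)] left[OF e2, of s'] exp_inverse_dominates[OF pos lim s'(1)]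
          eventually_ge_at_top[of n0]
      proof eventually_elim
        case (elim n)
        note [measurable] = meas[OF elim(4)]
        have "?P n \<le> prob ({\<omega> \<in> space M. Z n \<omega> \<le> - (e/2)} \<union> {\<omega> \<in> space M. Z n \<omega> > s})"
          using sub by (intro finite_measure_mono) auto
        also have "\<dots> \<le> prob {\<omega> \<in> space M. Z n \<omega> \<le> - (e/2)} + prob {\<omega> \<in> space M. Z n \<omega> > s}"
          by (intro measure_Un_le) auto
        finally show ?case using elim by linarith
      qed
    qed
    with pos have "eventually (\<lambda>n. ?L n \<le> ereal (- r)) sequentially"
      by eventually_elim (rule scaled_log_le, auto)
    then show ?thesis by (rule Limsup_bounded)
  qed
  show "limsup ?L \<le> - (INF x\<in>C. I_MD x)"
    using bound by (rule ereal_le_uminus_dense)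
next
  fix U :: "real set" assume U: "open U"
  let ?P = "\<lambda>n. prob {\<omega> \<in> space M. Z n \<omega> \<in> U}"
  let ?L = "\<lambda>n. ereal (1 / (1 / a n)) * ereal_log (?P n)"
  have bound: "ereal (- r) \<le> liminf ?L" if r: "(INF x\<in>U. I_MD x) < ereal r" for r
  proof -
    obtain x where x: "x \<in> U" "I_MD x < ereal r" using r unfolding INF_less_iff by blast
    then have x0: "0 \<le> x" "x < r" by (auto simp: I_MD_def split: if_splits)
    obtain e where e: "e > 0" "ball x e \<subseteq> U" using U x(1) openE by blast
    \<comment> \<open>The numbers are ordered \<open>x < b < r1 < r2 < min r c\<close>. The tail
      beyond \<open>b\<close> is at least \<open>exp (- r1 / a n)\<close>, that beyond
      \<open>c\<close> at most \<open>exp (- r2 / a n)\<close>, eventually no more than half of it.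
      The difference is thus at least \<open>exp (- r2 / a n)\<close>. Taking \<open>b > x\<close>
      makes the lower tail bound available even for \<open>x = 0\<close>.\<close>
    define c where "c = x + e/2"
    have cU: "y \<in> U" if "x < y" "y \<le> c" for y
      using that e by (auto simp: c_def subset_iff dist_real_def)
    obtain r1 where r1: "x < r1" "r1 < min r c"
      using dense[of x "min r c"] x0 e(1) by (auto simp: c_def)
    obtain b where b: "x < b" "b < r1" using dense r1 by blast
    obtain r2 where r2: "r1 < r2" "r2 < min r c" using dense r1 by blast
    have pos': "0 < b" "0 < r2" "r2 < c" using b r1 r2 x0 by auto
    have "eventually (\<lambda>n. exp (- r / a n) \<le> ?P n) sequentially"
      using pos lower[OF pos'(1) b(2)] upper[OF pos'(2,3)] exp_inverse_dominates[OF pos lim r2(1)]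
        eventually_ge_at_top[of n0]
    proof eventually_elim
      case (elim n)
      note [measurable] = meas[OF elim(5)] and [measurable] = borel_open[OF U]
      have "prob {\<omega> \<in> space M. Z n \<omega> > b} \<le> prob ({\<omega> \<in> space M. Z n \<omega> \<in> U} \<union> {\<omega> \<in> space M. Z n \<omega> > c})"
        using cU b by (intro finite_measure_mono) force+
      also have "\<dots> \<le> ?P n + prob {\<omega> \<in> space M. Z n \<omega> > c}"
        by (intro measure_Un_le) auto
      finally have *: "prob {\<omega> \<in> space M. Z n \<omega> > b} \<le> ?P n + prob {\<omega> \<in> space M. Z n \<omega> > c}" .
      have "exp (- r / a n) \<le> exp (- r2 / a n)" using r2 elim(1) by (simp add: divide_right_mono)
      then show ?case using * elim by linarith
    qed
    with pos have "eventually (\<lambda>n. ereal (- r) \<le> ?L n) sequentially"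
      by eventually_elim (rule scaled_log_ge, auto)
    then show ?thesis by (rule Liminf_bounded)
  qed
  show "- (INF x\<in>U. I_MD x) \<le> liminf ?L"
    using bound by (rule ereal_uminus_le_dense)
qed (use meas I_MD_rate_function in auto)

section \<open>Distribution of the maximum\<close>

lemma (in prob_space) prob_max_seq_le:
  assumes indep: "indep_vars (\<lambda>_. borel) X {1..}"
    and cdf: "\<And>n. n \<ge> 1 \<Longrightarrow> cdf (distr M borel (X n)) = F"
    and n: "n \<ge> 1"
  shows "prob {\<omega> \<in> space M. max_seq X n \<omega> \<le> y} = F y ^ n"
proof -
  have meas: "X i \<in> borel_measurable M" if "i \<ge> 1" for i
    using indep that by (auto simp: indep_vars_def)
  have "{\<omega> \<in> space M. max_seq X n \<omega> \<le> y} = (\<Inter>i\<in>{1..n}. X i -` {..y} \<inter> space M)"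
    using n by (auto simp: max_seq_def)
  also have "prob \<dots> = (\<Prod>i\<in>{1..n}. prob (X i -` {..y} \<inter> space M))"
    by (rule indep_varsD[OF indep]) (use n in auto)
  also have "\<dots> = (\<Prod>i\<in>{1..n}. F y)"
  proof (rule prod.cong[OF refl])
    fix i assume "i \<in> {1..n}"
    then have "i \<ge> 1" by simp
    then show "prob (X i -` {..y} \<inter> space M) = F y"
      using cdf[of i, symmetric] meas[of i] by (simp add: cdf_def measure_distr)
  qed
  finally show ?thesis by simp
qed

lemma max_seq_measurable:
  assumes "\<And>i. i \<ge> 1 \<Longrightarrow> X i \<in> borel_measurable M" "n \<ge> 1"
  shows "max_seq X n \<in> borel_measurable M"
  unfolding max_seq_def[abs_def]
  by (intro borel_measurable_Max) (use assms in auto)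

section \<open>Differentiability of the distribution function and decay of its tail\<close>

lemma increasing_with_density_continuous_on:
  assumes "increasing_with_density_from F f x0"
  shows "continuous_on {x0..b} F"
proof (cases "x0 \<le> b")
  case True
  have int: "(f has_integral (F y - F x0)) {x0..y}" if "x0 \<le> y" for y
    using assms that by (simp add: increasing_with_density_from_def)
  have "continuous_on {x0..b} (\<lambda>y. F x0 + integral {x0..y} f)"
    using int[OF True] by (intro continuous_intros indefinite_integral_continuous_1) auto
  then show ?thesis
    by (rule continuous_on_eq) (simp add: integral_unique[OF int])
qed simp

text \<open>The density gives \<open>F\<close> only as an integral, so a pointwise derivative comes
  from the fundamental theorem where \<open>f\<close> is continuous. Integration starts at
  \<open>A\<close>, since continuity is assumed only from there.\<close>

lemma increasing_with_density_has_derivative: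
  assumes dens: "increasing_with_density_from F f x0"
    and cont: "continuous_on {A..B} f" and A: "x0 \<le> A" "A < y" "y < B"
  shows "(F has_real_derivative f y) (at y)"
proof -
  have "((\<lambda>y. integral {A..y} f) has_real_derivative f y) (at y within {A..B})"
    using A by (intro integral_has_real_derivative cont) auto
  then have "((\<lambda>y. F A + integral {A..y} f) has_real_derivative f y) (at y)"
    using A by (subst (asm) at_within_Icc_at) (auto intro!: derivative_eq_intros)
  moreover have "F z = F A + integral {A..z} f" if "z > A" for z
  proof -
    have "(f has_integral (F z - F A)) {A..z}"
      using dens A that by (simp add: increasing_with_density_from_def)
    then show ?thesis by (simp add: integral_unique)
  qed
  ultimately show ?thesis
    using A by (elim has_field_derivative_transform_within_open[where S="{A<..}"]) auto
qed

lemma tail_log_ratio_tendsto: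
  fixes F f w :: "real \<Rightarrow> real" and a m y :: "nat \<Rightarrow> real"
  assumes rv: "regularly_varying w \<rho>"
    and cont: "continuous_on {A..} w" and pos: "\<And>t. t \<ge> A \<Longrightarrow> w t > 0"
    and lt1: "\<And>t. F t < 1"
    and deriv: "\<And>t. t > A \<Longrightarrow> (F has_real_derivative (1 - F t) / w t) (at t)"
    and m: "filterlim m at_top sequentially"
    and a: "eventually (\<lambda>n. a n > 0) sequentially"
    and am: "filterlim (\<lambda>n. a n * (m n / w (m n))) at_top sequentially"
    and y: "eventually (\<lambda>n. y n = m n + x * w (m n) / a n) sequentially"
  shows "(\<lambda>n. a n * (ln (1 - F (y n)) - ln (1 - F (m n)))) \<longlonglongrightarrow> - x"
proof -
  \<comment> \<open>The bound on \<open>\<bar>\<xi> - p\<bar>\<close> serves both orders of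
    \<open>p\<close> and \<open>q\<close>, as \<open>x\<close> may have either sign.\<close>
  have mvt: "\<exists>\<xi>. \<bar>\<xi> - p\<bar> \<le> \<bar>q - p\<bar> \<and> ln (1 - F q) - ln (1 - F p) = - (q - p) / w \<xi>"
    if pq: "p > A" "q > A" for p q
  proof -
    have D: "((\<lambda>t. ln (1 - F t)) has_real_derivative - 1 / w t) (at t)" if "t > A" for t
      using lt1[of t] pos[of t] that
      by (auto intro!: derivative_eq_intros deriv simp: field_simps)
    consider "p < q" | "p = q" | "q < p" by linarith
    then show ?thesis
    proof cases
      case 1
      obtain \<xi> where "p < \<xi>" "\<xi> < q" "ln (1 - F q) - ln (1 - F p) = (q - p) * (- 1 / w \<xi>)"
        using MVT2[OF 1, of "\<lambda>t. ln (1 - F t)" "\<lambda>t. - 1 / w t"] D pq by auto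
      then show ?thesis by (intro exI[of _ \<xi>]) (auto simp: algebra_simps diff_divide_distrib)
    next
      case 2
      then show ?thesis by (intro exI[of _ p]) auto
    next
      case 3
      obtain \<xi> where "q < \<xi>" "\<xi> < p" "ln (1 - F p) - ln (1 - F q) = (p - q) * (- 1 / w \<xi>)"
        using MVT2[OF 3, of "\<lambda>t. ln (1 - F t)" "\<lambda>t. - 1 / w t"] D pq by auto
      then show ?thesis by (intro exI[of _ \<xi>]) (auto simp: algebra_simps diff_divide_distrib)
    qed
  qed
  have "\<forall>n. \<exists>\<xi>. m n > A \<and> y n > A \<longrightarrow> \<bar>\<xi> - m n\<bar> \<le> \<bar>y n - m n\<bar> \<and>
      ln (1 - F (y n)) - ln (1 - F (m n)) = - (y n - m n) / w \<xi>"
    using mvt by blast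
  then obtain \<xi> where \<xi>: "\<And>n. m n > A \<Longrightarrow> y n > A \<Longrightarrow> \<bar>\<xi> n - m n\<bar> \<le> \<bar>y n - m n\<bar>"
      "\<And>n. m n > A \<Longrightarrow> y n > A \<Longrightarrow> ln (1 - F (y n)) - ln (1 - F (m n)) = - (y n - m n) / w (\<xi> n)"
    by metis
  have m_gt: "eventually (\<lambda>n. m n > K) sequentially" for K
    using m by (simp add: filterlim_at_top_dense)
  have rel: "(\<lambda>n. x / (a n * (m n / w (m n)))) \<longlonglongrightarrow> 0"
    by (rule real_tendsto_divide_at_top[OF tendsto_const am])
  have rel_eq: "eventually (\<lambda>n. y n / m n - 1 = x / (a n * (m n / w (m n)))) sequentially"
    using y a m_gt[of 0] m_gt[of A]
    by eventually_elim (simp add: add_divide_distrib)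
  have ym: "(\<lambda>n. y n / m n - 1) \<longlonglongrightarrow> 0"
    using rel tendsto_cong[OF rel_eq] by simp
  \<comment> \<open>Eventually \<open>y n > m n / 2\<close> and
    \<open>m n > 2 * \<bar>A\<bar>\<close>, so \<open>y n\<close> also lies in the region where
    \<open>F\<close> is differentiable.\<close>
  have y_gt: "eventually (\<lambda>n. y n > A) sequentially"
  proof -
    have "eventually (\<lambda>n. y n / m n - 1 > - 1/2) sequentially"
      by (rule order_tendstoD(1)[OF ym]) simp
    then show ?thesis using m_gt[of 0] m_gt[of "2 * \<bar>A\<bar>"]
      by eventually_elim (simp add: field_simps)
  qed
  have "(\<lambda>n. \<xi> n / m n - 1) \<longlonglongrightarrow> 0"
  proof (rule Lim_null_comparison)
    show "(\<lambda>n. \<bar>y n / m n - 1\<bar>) \<longlonglongrightarrow> 0" using ym by (rule tendsto_rabs_zero)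
    show "eventually (\<lambda>n. norm (\<xi> n / m n - 1) \<le> \<bar>y n / m n - 1\<bar>) sequentially"
      using m_gt[of A] m_gt[of 0] y_gt
    proof eventually_elim
      case (elim n)
      have "\<bar>z / m n - 1\<bar> = \<bar>z - m n\<bar> / m n" for z
        using elim by (simp add: abs_if field_simps)
      then show ?case using \<xi>(1)[of n] elim by (simp add: divide_right_mono)
    qed
  qed
  then have "(\<lambda>n. \<xi> n / m n) \<longlonglongrightarrow> 1" by (simp add: LIM_zero_iff)
  then have "(\<lambda>n. w (m n) / w (\<xi> n)) \<longlonglongrightarrow> 1"
    by (intro regularly_varying_ratio_tendsto_1[OF rv cont pos m])
  then have "(\<lambda>n. - x * (w (m n) / w (\<xi> n))) \<longlonglongrightarrow> - x * 1" by (intro tendsto_intros)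
  moreover have "eventually (\<lambda>n. - x * (w (m n) / w (\<xi> n)) =
      a n * (ln (1 - F (y n)) - ln (1 - F (m n)))) sequentially"
    using m_gt[of A] y_gt a y
  proof eventually_elim
    case (elim n)
    then have "a n * (ln (1 - F (y n)) - ln (1 - F (m n))) = a n * (- (x * w (m n) / a n) / w (\<xi> n))"
      using \<xi>(2)[of n] by simp
    then show ?case using elim by simp
  qed
  ultimately show ?thesis by (simp add: tendsto_cong)
qed

section \<open>Elementary exponential inequalities\<close>

lemma power_complement_le_exp:
  fixes p :: real
  assumes "p \<le> 1"
  shows "(1 - p) ^ n \<le> exp (- (real n * p))"
proof -
  have "(1 - p) ^ n \<le> exp (- p) ^ n"
    using exp_ge_add_one_self[of "- p"] assms by (intro power_mono) auto
  then show ?thesis by (simp add: exp_of_nat_mult[symmetric])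
qed

text \<open>From \<open>exp q \<ge> 1 + q\<close> it remains to see
  \<open>(1 + q) * (1 - q / 2) \<ge> 1\<close>, which is \<open>q * q \<le> q\<close>. It serves to
  bound an upper tail of the maximum below by \<open>q / 2\<close>.\<close>

lemma exp_minus_le_half:
  fixes q :: real
  assumes "0 \<le> q" "q \<le> 1"
  shows "exp (- q) \<le> 1 - q / 2"
proof -
  have "exp (- q) \<le> 1 / (1 + q)"
    using exp_ge_add_one_self[of q] assms by (simp add: exp_minus field_simps)
  also have "\<dots> \<le> 1 - q / 2"
    using assms mult_right_mono[of q 1 q] by (simp add: field_simps)
  finally show ?thesis .
qed

section \<open>Quantiles and admissible indices\<close>

lemma right_endpoint_infinite_less_1:
  assumes "mono F" "right_endpoint F = \<infinity>"
  shows "F x < 1"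
proof (rule ccontr)
  assume *: "\<not> ?thesis"
  have "right_endpoint F \<le> ereal x"
    unfolding right_endpoint_def
  proof (rule SUP_least)
    fix z assume "z \<in> {x. F x < 1}"
    then have "\<not> x \<le> z" using * monoD[OF assms(1), of x z] by auto
    then show "ereal z \<le> ereal x" by simp
  qed
  with assms(2) show False by simp
qed

lemma m_seq_inverse:
  assumes inc: "increasing_with_density_from F f x0" and mem: "1 - 1 / real n \<in> F ` {x0..}"
  shows "m_seq F x0 n \<ge> x0" "F (m_seq F x0 n) = 1 - 1 / real n"
proof -
  have inj: "inj_on F {x0..}"
    using inc by (auto simp: increasing_with_density_from_def intro: strict_mono_on_imp_inj_on)
  show "m_seq F x0 n \<ge> x0"
    using the_inv_into_into[OF inj mem order_refl] by (simp add: m_seq_def)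
  show "F (m_seq F x0 n) = 1 - 1 / real n"
    unfolding m_seq_def by (rule f_the_inv_into_f[OF inj mem])
qed

text \<open>The levels \<open>1 - 1 / real n\<close> eventually pass the fixed value
  \<open>F (max K x0) < 1\<close>. The maximum with \<open>x0\<close> stays in the half-line where
  \<open>F\<close> is monotone, and the implication restricts to levels where the inverse is
  meaningful.\<close>

lemma m_seq_gt:
  assumes inc: "increasing_with_density_from F f x0" and lt1: "F (max K x0) < 1"
  shows "eventually (\<lambda>n. 1 - 1 / real n \<in> F ` {x0..} \<longrightarrow> m_seq F x0 n > K) sequentially"
proof -
  have "(\<lambda>n. 1 - 1 / real n) \<longlonglongrightarrow> 1 - 0" by (intro tendsto_intros lim_1_over_n)
  then have "eventually (\<lambda>n. F (max K x0) < 1 - 1 / real n) sequentially"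
    using lt1 by (intro order_tendstoD(1)) auto
  then show ?thesis
  proof (eventually_elim, intro impI)
    fix n assume n: "F (max K x0) < 1 - 1 / real n" and mem: "1 - 1 / real n \<in> F ` {x0..}"
    have mono: "strict_mono_on {x0..} F"
      using inc by (simp add: increasing_with_density_from_def)
    note m = m_seq_inverse[OF inc mem]
    show "m_seq F x0 n > K"
    proof (rule ccontr)
      assume "\<not> ?thesis"
      then have "F (m_seq F x0 n) \<le> F (max K x0)"
        using m(1) by (intro strict_mono_on_leD[OF mono]) auto
      with m(2) n show False by simp
    qed
  qed
qed

text \<open>Large levels lie between \<open>F x0\<close> and the limit 1, so the intermediate value
  theorem attains them; \<open>m_seq_gt\<close> with \<open>K = 0\<close> keeps the quantile away
  from 0.\<close>

lemma admissible_index_exists: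
  assumes inc: "increasing_with_density_from F f x0" and lt1: "\<And>x. F x < 1"
    and lim: "(F \<longlongrightarrow> 1) at_top"
  shows "\<exists>n0. admissible_index F x0 n0"
proof -
  have "(\<lambda>n. 1 - 1 / real n) \<longlonglongrightarrow> 1 - 0" by (intro tendsto_intros lim_1_over_n)
  then have "eventually (\<lambda>n. F x0 < 1 - 1 / real n) sequentially"
    using lt1[of x0] by (intro order_tendstoD(1)) auto
  then have "eventually (\<lambda>n. 1 \<le> n \<and> 1 - 1 / real n \<in> F ` {x0..} \<and> m_seq F x0 n \<noteq> 0) sequentially"
    using eventually_ge_at_top[of 1] m_seq_gt[OF inc lt1, of 0]
  proof eventually_elim
    case (elim n)
    have "eventually (\<lambda>z. F z > 1 - 1 / real n) at_top"
      using elim by (intro order_tendstoD(1)[OF lim]) auto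
    then have "eventually (\<lambda>z. F z > 1 - 1 / real n \<and> z \<ge> x0) at_top"
      using eventually_ge_at_top by (rule eventually_conj)
    then obtain b where b: "F b > 1 - 1 / real n" "b \<ge> x0"
      by (auto simp: eventually_at_top_linorder)
    obtain z where "z \<ge> x0" "F z = 1 - 1 / real n"
      using IVT'[of F x0 "1 - 1 / real n" b] b elim increasing_with_density_continuous_on[OF inc, of b]
      by auto
    then have "1 - 1 / real n \<in> F ` {x0..}" by (metis atLeast_iff imageI)
    with elim show ?case by auto
  qed
  then obtain n0 where "\<And>n. n \<ge> n0 \<Longrightarrow> 1 \<le> n \<and> 1 - 1 / real n \<in> F ` {x0..} \<and> m_seq F x0 n \<noteq> 0"
    by (auto simp: eventually_sequentially)
  then have "admissible_index F x0 n0" by (auto simp: admissible_index_def)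
  then show ?thesis ..
qed

section \<open>The moderate deviation principle for the maximum\<close>

theorem proposition4p1:
  fixes M :: "'a measure"
    and X :: "nat \<Rightarrow> 'a \<Rightarrow> real"
    and F f :: "real \<Rightarrow> real"
    and x0 \<mu> :: real
  assumes "prob_space M"
    and "prob_space.indep_vars M (\<lambda>_. borel) X {1..}"
    and "\<And>n. n \<ge> 1 \<Longrightarrow> cdf (distr M borel (X n)) = F"
    and "right_endpoint F = \<infinity>"
    and "increasing_with_density_from F f x0"
    and "eventually (\<lambda>x. w_fun F f differentiable (at x)) at_top"
    and "(deriv (w_fun F f) \<longlongrightarrow> 0) at_top"
    and "\<mu> > 0"
    and "regularly_varying (w_fun F f) (1 - \<mu>)"
  shows "(\<exists>n0. admissible_index F x0 n0) \<and>
    (\<forall>n0. admissible_index F x0 n0 \<longrightarrow>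
      (\<forall>a :: nat \<Rightarrow> real.
        (\<forall>n\<ge>n0. a n > 0) \<longrightarrow>
        a \<longlonglongrightarrow> 0 \<longrightarrow>
        filterlim (\<lambda>n. a n * h_seq F f x0 n) at_top sequentially \<longrightarrow>
        satisfies_LDP M n0
          (\<lambda>n \<omega>. a n * h_seq F f x0 n * (max_seq X n \<omega> / m_seq F x0 n - 1))
          (\<lambda>n. 1 / a n) I_MD))"
proof -
  interpret prob_space M by fact
  note indep = assms(2) and cdf = assms(3) and inc = assms(5)
  have measX: "X i \<in> borel_measurable M" if "i \<ge> 1" for i
    using indep that by (auto simp: indep_vars_def)
  interpret D: real_distribution "distr M borel (X 1)"
    using measX by (intro real_distribution_distr) auto
  have F: "F = cdf (distr M borel (X 1))" using cdf[of 1] by simp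
  have F_nonneg: "0 \<le> F x" for x
    unfolding F by (rule D.cdf_nonneg)
  have F_lim: "(F \<longlongrightarrow> 1) at_top"
    unfolding F by (rule D.cdf_lim_at_top_prob)
  have lt1: "F x < 1" for x
    using D.cdf_nondecreasing assms(4)
    by (intro right_endpoint_infinite_less_1) (auto simp: F mono_def)
  define w where "w = w_fun F f"
  obtain A0 where A0: "\<And>x. x \<ge> A0 \<Longrightarrow> w differentiable (at x)"
    using assms(6) by (auto simp: eventually_at_top_linorder w_def)
  define A where "A = max A0 x0"
  have w_cont: "continuous_on {A..} w"
    by (intro differentiable_imp_continuous_on differentiable_at_imp_differentiable_on)
      (auto simp: A_def intro: A0)
  have f_pos: "f t > 0" if "t \<ge> x0" for t
    using inc that by (simp add: increasing_with_density_from_def)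
  have w_pos: "w t > 0" if "t \<ge> A" for t
    using f_pos[of t] lt1[of t] that by (simp add: w_def w_fun_def A_def)
  have f_eq: "f t = (1 - F t) / w t" if "t \<ge> A" for t
    using f_pos[of t] lt1[of t] that by (simp add: w_def w_fun_def A_def)
  \<comment> \<open>Beyond \<open>A\<close> the density equals \<open>(1 - F t) / w t\<close>, a
    quotient of continuous functions, hence is continuous. The right end \<open>t + 1\<close> makes
    \<open>t\<close> an interior point.\<close>
  have F_deriv: "(F has_real_derivative (1 - F t) / w t) (at t)" if t: "t > A" for t
  proof -
    have "continuous_on {A..B} (\<lambda>t. (1 - F t) / w t)" for B
      using w_pos by (intro continuous_intros continuous_on_subset[OF w_cont]
          continuous_on_subset[OF increasing_with_density_continuous_on[OF inc, of B]])
        (force simp: A_def)+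
    then have "continuous_on {A..t + 1} f"
      by (rule continuous_on_eq) (simp add: f_eq)
    from increasing_with_density_has_derivative[OF inc this] t show ?thesis
      by (simp add: f_eq A_def)
  qed
  have "satisfies_LDP M n0
          (\<lambda>n \<omega>. a n * h_seq F f x0 n * (max_seq X n \<omega> / m_seq F x0 n - 1)) (\<lambda>n. 1 / a n) I_MD"
    if adm: "admissible_index F x0 n0" and a_pos: "\<forall>n\<ge>n0. a n > 0" and a_lim: "a \<longlonglongrightarrow> 0"
      and ah_lim: "filterlim (\<lambda>n. a n * h_seq F f x0 n) at_top sequentially"
    for n0 and a :: "nat \<Rightarrow> real"
  proof -
    define m where "m = m_seq F x0"
    define h where "h = h_seq F f x0"
    \<comment> \<open>\<open>Z n\<close> exceeds \<open>x\<close> exactly when the maximum exceeds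
      \<open>y x n\<close>, for large \<open>n\<close>; \<open>q x n\<close> is the expected number
      of the first \<open>n\<close> variables above that threshold.\<close>
    define y where "y = (\<lambda>x n. m n * (1 + x / (a n * h n)))"
    define q where "q = (\<lambda>x n. real n * (1 - F (y x n)))"
    have n0: "n0 \<ge> 1" using adm by (simp add: admissible_index_def)
    have ev_n: "eventually (\<lambda>n. n \<ge> n0) sequentially" by (rule eventually_ge_at_top)
    have ev_a: "eventually (\<lambda>n. a n > 0) sequentially"
      using ev_n by eventually_elim (use a_pos in simp)
    have Fm: "F (m n) = 1 - 1 / real n" if "n \<ge> n0" for n
      using m_seq_inverse(2)[OF inc] adm that by (simp add: m_def admissible_index_def)
    have m_lim: "filterlim m at_top sequentially"
      unfolding filterlim_at_top_dense
    proof
      fix K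
      show "eventually (\<lambda>n. m n > K) sequentially"
        using m_seq_gt[OF inc lt1, of K] ev_n
        by eventually_elim (use adm in \<open>auto simp: admissible_index_def m_def\<close>)
    qed
    have ev_m: "eventually (\<lambda>n. m n > K) sequentially" for K
      using m_lim by (simp add: filterlim_at_top_dense)
    have h_eq: "eventually (\<lambda>n. h n = m n / w (m n)) sequentially"
      using ev_n
      by eventually_elim (use Fm n0 in \<open>simp add: h_def h_seq_def w_def w_fun_def flip: m_def\<close>)
    have ah_lim': "filterlim (\<lambda>n. a n * (m n / w (m n))) at_top sequentially"
    proof -
      have "eventually (\<lambda>n. a n * h n = a n * (m n / w (m n))) sequentially"
        using h_eq by eventually_elim simp
      from filterlim_cong[OF refl refl this] ah_lim show ?thesis by (simp only: h_def)
    qed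
    have ev_ah: "eventually (\<lambda>n. a n * h n > 0) sequentially"
      using ah_lim by (simp add: filterlim_at_top_dense h_def)
    have y_eq: "eventually (\<lambda>n. y x n = m n + x * w (m n) / a n) sequentially" for x
      using h_eq ev_m[of 0] ev_m[of A] ev_a
      by eventually_elim (use w_pos in \<open>simp add: y_def field_simps\<close>)
    have q_pos: "eventually (\<lambda>n. q x n > 0) sequentially" for x
      using ev_n by eventually_elim (use n0 lt1 in \<open>simp add: q_def\<close>)
    \<comment> \<open>The factor \<open>n\<close> in \<open>q\<close> comes from
      \<open>1 - F (m n) = 1 / real n\<close>, which makes \<open>- ln (1 - F (m n))\<close> equal
      to \<open>ln n\<close>.\<close>
    have q_lim: "(\<lambda>n. a n * ln (q x n)) \<longlonglongrightarrow> - x" for x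
    proof -
      have "(\<lambda>n. a n * (ln (1 - F (y x n)) - ln (1 - F (m n)))) \<longlonglongrightarrow> - x"
        by (rule tail_log_ratio_tendsto[OF _ w_cont w_pos lt1 F_deriv m_lim ev_a ah_lim' y_eq])
          (use assms(9) in \<open>auto simp: w_def\<close>)
      moreover have "eventually (\<lambda>n. a n * (ln (1 - F (y x n)) - ln (1 - F (m n))) = a n * ln (q x n)) sequentially"
        using ev_n
      proof eventually_elim
        case (elim n)
        with n0 lt1[of "y x n"] have "real n > 0" "1 - F (y x n) > 0" by auto
        then show ?case using Fm[OF elim] by (simp add: q_def ln_mult ln_div)
      qed
      ultimately show ?thesis by (simp add: tendsto_cong)
    qed
    have q_le: "eventually (\<lambda>n. q x n \<le> exp (- r / a n)) sequentially" if "r < x" for x r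
    proof -
      have "eventually (\<lambda>n. a n * ln (q x n) < - r) sequentially"
        using that by (intro order_tendstoD(2)[OF q_lim]) simp
      with ev_a q_pos[of x] show ?thesis
      proof eventually_elim
        case (elim n)
        then have "ln (q x n) \<le> - r / a n" by (simp add: field_simps)
        then have "exp (ln (q x n)) \<le> exp (- r / a n)" by simp
        then show ?case using elim(2) by (simp only: exp_ln)
      qed
    qed
    have q_ge: "eventually (\<lambda>n. exp (- r / a n) \<le> q x n) sequentially" if "x < r" for x r
    proof -
      have "eventually (\<lambda>n. a n * ln (q x n) > - r) sequentially"
        using that by (intro order_tendstoD(1)[OF q_lim]) simp
      with ev_a q_pos[of x] show ?thesis
      proof eventually_elim
        case (elim n)
        then have "- r / a n \<le> ln (q x n)" by (simp add: field_simps)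
        then show ?case using elim by (simp add: ln_ge_iff)
      qed
    qed
    \<comment> \<open>This and \<open>power_ge\<close> enclose the distribution function of the
      maximum between \<open>1 - q\<close> and \<open>exp (- q)\<close>.\<close>
    have power_le: "F (y x n) ^ n \<le> exp (- q x n)" for x n
      using power_complement_le_exp[of "1 - F (y x n)" n] F_nonneg by (simp add: q_def)
    have power_ge: "1 - q x n \<le> F (y x n) ^ n" for x n
      using Bernoulli_inequality[of "F (y x n) - 1" n] F_nonneg[of "y x n"] by (simp add: q_def algebra_simps)
    have max_meas: "max_seq X n \<in> borel_measurable M" if "n \<ge> n0" for n
      using that n0 by (intro max_seq_measurable measX) auto
    define Z where "Z = (\<lambda>n \<omega>. a n * h n * (max_seq X n \<omega> / m n - 1))"
    have Z_meas: "Z n \<in> borel_measurable M" if "n \<ge> n0" for n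
      using max_meas[OF that] unfolding Z_def by measurable
    have Z_le_iff: "eventually (\<lambda>n. \<forall>\<omega>. Z n \<omega> \<le> x \<longleftrightarrow> max_seq X n \<omega> \<le> y x n) sequentially" for x
      using ev_ah ev_m[of 0]
    proof eventually_elim
      case (elim n)
      show ?case
      proof
        fix \<omega>
        have "Z n \<omega> \<le> x \<longleftrightarrow> max_seq X n \<omega> / m n - 1 \<le> x / (a n * h n)"
          using elim by (simp add: Z_def pos_le_divide_eq mult.commute)
        also have "\<dots> \<longleftrightarrow> max_seq X n \<omega> / m n \<le> 1 + x / (a n * h n)" by linarith
        also have "\<dots> \<longleftrightarrow> max_seq X n \<omega> \<le> y x n"
          using elim by (simp add: y_def pos_divide_le_eq mult.commute)
        finally show "Z n \<omega> \<le> x \<longleftrightarrow> max_seq X n \<omega> \<le> y x n" .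
      qed
    qed
    have Z_le: "eventually (\<lambda>n. prob {\<omega> \<in> space M. Z n \<omega> \<le> x} = F (y x n) ^ n) sequentially" for x
      using Z_le_iff[of x] ev_n
      by eventually_elim (use n0 in \<open>simp add: prob_max_seq_le[OF indep cdf]\<close>)
    have Z_gt: "eventually (\<lambda>n. prob {\<omega> \<in> space M. Z n \<omega> > x} = 1 - F (y x n) ^ n) sequentially" for x
      using Z_le[of x] ev_n
    proof eventually_elim
      case (elim n)
      note [measurable] = Z_meas[OF elim(2)]
      have "prob {\<omega> \<in> space M. \<not> Z n \<omega> \<le> x} = 1 - prob {\<omega> \<in> space M. Z n \<omega> \<le> x}"
        by (rule prob_neg) measurable
      then show ?case using elim by (simp add: not_le)
    qed
    have "satisfies_LDP M n0 Z (\<lambda>n. 1 / a n) I_MD"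
    proof (rule LDP_I_MD_of_tails[OF Z_meas ev_a a_lim])
      fix x r :: real assume "0 < r" "r < x"
      show "eventually (\<lambda>n. prob {\<omega> \<in> space M. Z n \<omega> > x} \<le> exp (- r / a n)) sequentially"
        using Z_gt[of x] q_le[OF \<open>r < x\<close>]
        by eventually_elim (use power_ge in \<open>smt (verit)\<close>)
    next
      fix x r :: real assume "0 < x" "x < r"
      obtain s where s: "x < s" "s < r" using dense[OF \<open>x < r\<close>] by blast
      show "eventually (\<lambda>n. exp (- r / a n) \<le> prob {\<omega> \<in> space M. Z n \<omega> > x}) sequentially"
        \<comment> \<open>Rate 0 in \<open>q_le\<close> gives \<open>q x n \<le> 1\<close>, as
          \<open>exp_minus_le_half\<close> requires. The resulting factor 1/2 is absorbed by passing
          from \<open>s\<close> to \<open>r\<close>.\<close>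
        using Z_gt[of x] q_le[OF \<open>0 < x\<close>] q_ge[OF s(1)] exp_inverse_dominates[OF ev_a a_lim s(2)]
          q_pos[of x]
      proof eventually_elim
        case (elim n)
        have "exp (- q x n) \<le> 1 - q x n / 2"
          using elim by (intro exp_minus_le_half) auto
        then show ?case using power_le[of x n] elim by linarith
      qed
    next
      fix x r :: real assume "x < 0"
      \<comment> \<open>Any \<open>d\<close> strictly between 0 and \<open>- x\<close> would do:
        then \<open>q x n \<ge> exp (d / a n)\<close> eventually. This outgrows every multiple of
        \<open>1 / a n\<close>, by the quadratic Taylor bound once
        \<open>2 * r * a n < d\<^sup>2\<close>, so \<open>exp (- q x n)\<close> beats every rate
        \<open>r\<close>.\<close>
      define d where "d = - x / 2"
      have d: "d > 0" "x < - d" using \<open>x < 0\<close> by (auto simp: d_def)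
      have "(\<lambda>n. 2 * r * a n) \<longlonglongrightarrow> 2 * r * 0" by (intro tendsto_intros a_lim)
      then have "eventually (\<lambda>n. 2 * r * a n < d\<^sup>2) sequentially"
        using d by (intro order_tendstoD(2)) auto
      then show "eventually (\<lambda>n. prob {\<omega> \<in> space M. Z n \<omega> \<le> x} \<le> exp (- r / a n)) sequentially"
        using Z_le[of x] q_ge[OF d(2)] ev_a
      proof eventually_elim
        case (elim n)
        have "r / a n \<le> (d / a n)\<^sup>2 / 2"
          using elim by (simp add: field_simps power2_eq_square)
        also have "\<dots> \<le> exp (d / a n)"
          using exp_lower_Taylor_quadratic[of "d / a n"] d elim by (smt (verit) divide_nonneg_pos)
        also have "\<dots> \<le> q x n" using elim by simp
        finally have "exp (- q x n) \<le> exp (- r / a n)" by simp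
        then show ?case using elim power_le[of x n] by linarith
      qed
    qed
    then show ?thesis by (simp add: Z_def m_def h_def)
  qed
  then show ?thesis
    using admissible_index_exists[OF inc lt1 F_lim] by blast
qed

end
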